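(* Let $\mathcal{C}_1\subseteq\mathbb{F}_{q^m}^n$ be a linear code and $\mathcal{C}_2\subsetneqq\mathcal{C}_1$ a subcode. Then the $i$-th relative dimension/intersection profile $K_{R,i}(\mathcal{C}_1,\mathcal{C}_2)$ is nondecreasing in $i$ from $K_{R,0}(\mathcal{C}_1,\mathcal{C}_2)=0$ to $K_{R,n}(\mathcal{C}_1,\mathcal{C}_2)=\dim(\mathcal{C}_1/\mathcal{C}_2)$, and $0\le K_{R,i+1}(\mathcal{C}_1,\mathcal{C}_2)-K_{R,i}(\mathcal{C}_1,\mathcal{C}_2)\le1$ for $0\le i\le n-1$.
   Context: $\mathbb{F}_{q^m}$ is the degree-$m$ extension ($m\ge1$) of the finite field $\mathbb{F}_q$. Linear codes are $\mathbb{F}_{q^m}$-subspaces of $\mathbb{F}_{q^m}^n$; dimensions are over $\mathbb{F}_{q^m}$. For a subspace $V\subseteq\mathbb{F}_{q^m}^n$ put $V^q=\{[v_1^q,\dots,v_n^q]: v\in V\}$. Let $\Gamma_i(\mathbb{F}_{q^m}^n)$ be the set of $i$-dimensional $\mathbb{F}_{q^m}$-subspaces $V\subseteq\mathbb{F}_{q^m}^n$ with $V=V^q$. For $0\le i\le n$, $K_{R,i}(\mathcal{C}_1,\mathcal{C}_2)=\max_{V\in\Gamma_i(\mathbb{F}_{q^m}^n)}\{\dim(\mathcal{C}_1\cap V)-\dim(\mathcal{C}_2\cap V)\}$. *)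

theory Defs
  imports "HOL-Analysis.Analysis" "HOL-Number_Theory.Prime_Powers"
begin

definition frobenius_image :: "nat \<Rightarrow> ('a::field ^ 'n) set \<Rightarrow> ('a ^ 'n) set" where
  "frobenius_image q V = (\<lambda>v. \<chi> j. (v $ j) ^ q) ` V"

definition Gamma :: "nat \<Rightarrow> nat \<Rightarrow> ('a::field ^ 'n) set set" where
  "Gamma q i = {V. vec.subspace V \<and> vec.dim V = i \<and> V = frobenius_image q V}"

(* Integer-valued, so that the difference of dimensions is not truncated.
   Over a finite field the maximum is over a finite set; it is meaningful only
   for i \<le> CARD('n), since Gamma q i is empty for larger i. *)
definition relative_profile ::
    "nat \<Rightarrow> nat \<Rightarrow> ('a::field ^ 'n) set \<Rightarrow> ('a ^ 'n) set \<Rightarrow> int" where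
  "relative_profile q i C1 C2 =
     Max ((\<lambda>V. int (vec.dim (C1 \<inter> V)) - int (vec.dim (C2 \<inter> V))) ` Gamma q i)"

definition quotient_space :: "('a::field ^ 'n) set \<Rightarrow> ('a ^ 'n) set \<Rightarrow> ('a ^ 'n) set set" where
  "quotient_space V W = (\<lambda>v. v +o W) ` V"

(* The linear combination, in the quotient by W, of the cosets A in B with
   coefficients u A. Sums are elementwise sums of sets; the summand W makes the
   result a coset also where B is empty or a coefficient is 0 (the elementwise
   multiple 0 * A is {0}, not the zero coset W). *)
definition coset_combination ::
    "('a::field ^ 'n) set \<Rightarrow> ('a ^ 'n) set set \<Rightarrow> (('a ^ 'n) set \<Rightarrow> 'a) \<Rightarrow> ('a ^ 'n) set" where
  "coset_combination W B u = W + (\<Sum>A\<in>B. (\<lambda>a. u A *s a) ` A)"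

definition quotient_basis ::
    "('a::field ^ 'n) set \<Rightarrow> ('a ^ 'n) set \<Rightarrow> ('a ^ 'n) set set \<Rightarrow> bool" where
  "quotient_basis V W B \<longleftrightarrow>
     finite B \<and> B \<subseteq> quotient_space V W \<and>
     (\<forall>u. coset_combination W B u = W \<longrightarrow> (\<forall>A\<in>B. u A = 0)) \<and>
     (\<forall>Q\<in>quotient_space V W. \<exists>u. Q = coset_combination W B u)"

definition quotient_dim :: "('a::field ^ 'n) set \<Rightarrow> ('a ^ 'n) set \<Rightarrow> nat" where
  "quotient_dim V W = (THE d. \<exists>B. quotient_basis V W B \<and> card B = d)"

end

theory Submission
  imports Defs "HOL-Number_Theory.Residues"
begin

text \<open>
  For nested subspaces \<open>V \<subseteq> W\<close>, the induced map from \<open>(C1 \<inter> V) / (C2 \<inter> V)\<close> to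
  \<open>(C1 \<inter> W) / (C2 \<inter> W)\<close> is injective, so the difference of dimensions can only grow; it grows by
  at most \<open>dim W - dim V\<close>. It remains to move up and down by one dimension inside the set of
  Frobenius-invariant subspaces, and no Galois descent is needed for this: a proper invariant
  subspace can be enlarged by a standard basis vector outside it, and a nonzero invariant subspace
  can be cut by a coordinate hyperplane that does not contain it.
\<close>

section \<open>Subspaces invariant under the coordinatewise \<open>q\<close>-power map\<close>

context
  fixes q m :: nat
  assumes primepow: "primepow q" and card: "CARD('a::{field,finite}) = q ^ m"
begin

text \<open>The characteristic divides the cardinality, a power of \<open>p\<close>, so it equals
  \<open>p\<close>; hence the \<open>q\<close>-th power is an iterate of the Frobenius map and the
  freshman's dream applies.\<close>

lemma frobenius_add: "((x::'a) + y) ^ q = x ^ q + y ^ q"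
proof -
  obtain p k where p: "prime p" and q: "q = p ^ k"
    using primepow by (auto simp: primepow_def)
  have prime: "prime CHAR('a)"
    by (intro prime_CHAR_semidom finite_imp_CHAR_pos) simp
  have "CHAR('a) dvd p ^ (k * m)"
    using CHAR_dvd_CARD[where ?'a = 'a] card q by (simp add: power_mult)
  then have "CHAR('a) = p"
    using prime p by (metis prime_dvd_power primes_dvd_imp_eq)
  then show ?thesis
    using q prime by (simp add: freshmans_dream')
qed

text \<open>Additivity turns equal \<open>q\<close>-th powers into \<open>(x - y) ^ q = 0\<close>,
  and a field has no nonzero nilpotents.\<close>

lemma frobenius_inj:
  assumes "(x::'a) ^ q = y ^ q"
  shows "x = y"
proof -
  have "x ^ q = (x - y) ^ q + y ^ q"
    using frobenius_add[of "x - y" y] by simp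
  then show ?thesis
    using assms by simp
qed

text \<open>An injective self-map of a finite set is onto, so invariance only requires one inclusion
  to be checked.\<close>

lemma frobenius_image_eqI:
  fixes V :: "('a ^ 'n) set"
  assumes "\<And>v. v \<in> V \<Longrightarrow> (\<chi> j. (v $ j) ^ q) \<in> V"
  shows "V = frobenius_image q V"
proof -
  have "inj_on (\<lambda>v :: 'a ^ 'n. \<chi> j. (v $ j) ^ q) V"
    by (rule inj_onI) (simp add: vec_eq_iff, blast intro: frobenius_inj)
  then show ?thesis
    unfolding frobenius_image_def
    using assms by (intro endo_inj_surj[symmetric]) auto
qed

text \<open>Standard basis vectors have entries 0 and 1, so the \<open>q\<close>-power map fixes
  them; adjoining one that lies outside \<open>V\<close> preserves invariance and raises the
  dimension by one.\<close>

lemma Gamma_extend: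
  fixes V :: "('a ^ 'n) set"
  assumes V: "V \<in> Gamma q i" and i: "i < CARD('n)"
  obtains W where "W \<in> Gamma q (Suc i)" "V \<subseteq> W"
proof -
  have sub: "vec.subspace V" and dim: "vec.dim V = i" and V_eq: "V = frobenius_image q V"
    using V by (auto simp: Gamma_def)
  have "\<exists>j. axis j 1 \<notin> V"
  proof (rule ccontr)
    assume "\<nexists>j. axis j 1 \<notin> V"
    then have "(\<Sum>j\<in>UNIV. x $ j *s axis j 1) \<in> V" for x
      using sub by (intro vec.subspace_sum vec.subspace_scale) auto
    then have "V = UNIV"
      by (auto simp: basis_expansion)
    then show False
      using dim i vec_dim_card[where ?'a = 'a and ?'n = 'n] by simp
  qed
  then obtain j where j: "axis j 1 \<notin> V"
    by blast
  define W where "W = vec.span (insert (axis j 1) V)"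
  have W_iff: "x \<in> W \<longleftrightarrow> (\<exists>c. x - c *s axis j 1 \<in> V)" for x
    using sub by (simp add: W_def vec.span_breakdown_eq vec.span_eq_iff[THEN iffD2])
  have "vec.dim W = Suc i"
    using j dim sub by (simp add: W_def vec.dim_insert vec.span_eq_iff[THEN iffD2])
  moreover have "W = frobenius_image q W"
  proof (rule frobenius_image_eqI)
    fix v assume "v \<in> W"
    then obtain c where c: "v - c *s axis j 1 \<in> V"
      by (auto simp: W_iff)
    define u where "u = v - c *s axis j 1"
    \<comment> \<open>The map is additive and sends \<open>c *s axis j 1\<close> to
      \<open>c ^ q *s axis j 1\<close>, which supplies the new coefficient. Off coordinate
      \<open>j\<close> this uses \<open>0 ^ q = 0\<close>, hence \<open>q > 0\<close>.\<close>
    have "(\<chi> k. (v $ k) ^ q) - c ^ q *s axis j 1 = (\<chi> k. (u $ k) ^ q)"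
    proof -
      have "v = u + c *s axis j 1"
        by (simp add: u_def)
      then show ?thesis
        using primepow_gt_0_nat[OF primepow]
        by (auto simp: vec_eq_iff frobenius_add power_mult_distrib axis_def)
    qed
    moreover have "(\<chi> k. (u $ k) ^ q) \<in> frobenius_image q V"
      unfolding frobenius_image_def using c by (intro imageI) (simp add: u_def)
    ultimately show "(\<chi> k. (v $ k) ^ q) \<in> W"
      using V_eq W_iff by metis
  qed
  ultimately have "W \<in> Gamma q (Suc i)"
    by (simp add: Gamma_def W_def)
  moreover have "V \<subseteq> W"
    by (auto simp: W_def intro: vec.span_base)
  ultimately show thesis
    by (rule that)
qed

text \<open>For \<open>q > 0\<close>, raising to the power \<open>q\<close> keeps a zero coordinate
  zero, so the part of \<open>W\<close> in a coordinate hyperplane is again invariant. The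
  hyperplane is chosen to miss some \<open>w\<close> in \<open>W\<close>.\<close>

lemma Gamma_cut:
  fixes W :: "('a ^ 'n) set"
  assumes W: "W \<in> Gamma q (Suc i)"
  obtains V where "V \<in> Gamma q i" "V \<subseteq> W"
proof -
  have sub: "vec.subspace W" and dim: "vec.dim W = Suc i" and W_eq: "W = frobenius_image q W"
    using W by (auto simp: Gamma_def)
  have "\<not> W \<subseteq> {0}"
    using dim vec.dim_eq_0[of W] by auto
  then obtain w where "w \<in> W" "w \<noteq> 0"
    by blast
  then obtain j where w: "w \<in> W" "w $ j \<noteq> 0"
    by (auto simp: vec_eq_iff)
  define V where "V = {x \<in> W. x $ j = 0}"
  have sub_V: "vec.subspace V"
    using sub by (auto simp: V_def vec.subspace_def)
  have "vec.span (insert w V) = W"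
  proof
    show "vec.span (insert w V) \<subseteq> W"
      using w sub by (intro vec.span_minimal) (auto simp: V_def)
    show "W \<subseteq> vec.span (insert w V)"
    proof
      fix x assume "x \<in> W"
      \<comment> \<open>The multiple of \<open>w\<close> is the one that cancels coordinate
        \<open>j\<close>, so \<open>V\<close> has codimension exactly one in
        \<open>W\<close>.\<close>
      then have "x - (x $ j / w $ j) *s w \<in> V"
        using w sub by (auto simp: V_def intro: vec.subspace_diff vec.subspace_scale)
      then show "x \<in> vec.span (insert w V)"
        by (auto simp: vec.span_breakdown_eq intro: vec.span_base)
    qed
  qed
  moreover have "w \<notin> vec.span V"
    using w sub_V by (simp add: V_def vec.span_eq_iff[THEN iffD2])
  ultimately have "vec.dim V = i"
    using vec.dim_insert[of w V] dim by (metis Suc_eq_plus1 old.nat.inject vec.dim_span)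
  moreover have "V = frobenius_image q V"
  proof (rule frobenius_image_eqI)
    fix v assume "v \<in> V"
    moreover have "(\<chi> k. (v $ k) ^ q) \<in> W" if "v \<in> W"
      using that W_eq by (auto simp: frobenius_image_def)
    ultimately show "(\<chi> k. (v $ k) ^ q) \<in> V"
      using primepow_gt_0_nat[OF primepow] by (auto simp: V_def)
  qed
  ultimately have "V \<in> Gamma q i"
    using sub_V by (simp add: Gamma_def)
  then show thesis
    by (rule that) (auto simp: V_def)
qed

lemma Gamma_0: "Gamma q 0 = {{0 :: 'a ^ 'n}}"
proof -
  have "{0 :: 'a ^ 'n} = frobenius_image q {0}"
    using primepow_gt_0_nat[OF primepow]
    by (auto simp: frobenius_image_def vec_eq_iff)
  moreover have "V = {0}" if "vec.subspace V" "vec.dim V = 0" for V :: "('a ^ 'n) set"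
    using that vec.subspace_0 by auto
  ultimately show ?thesis
    by (auto simp: Gamma_def vec.subspace_single_0)
qed

lemma Gamma_CARD: "Gamma q CARD('n) = {UNIV :: ('a ^ 'n) set}"
proof -
  have "UNIV = frobenius_image q (UNIV :: ('a ^ 'n) set)"
    by (rule frobenius_image_eqI) simp
  moreover have "V = UNIV" if "vec.subspace V" "vec.dim V = CARD('n)" for V :: "('a ^ 'n) set"
    using that vec.subspace_dim_equal[of V UNIV] vec_dim_card[where ?'a = 'a and ?'n = 'n] by simp
  ultimately show ?thesis
    using vec_dim_card[where ?'a = 'a and ?'n = 'n] by (auto simp: Gamma_def)
qed

text \<open>Starting from the zero space, \<open>Gamma_extend\<close> climbs one dimension at a
  time. This guarantees that the \<open>Max\<close> in the profile is taken over a nonempty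
  set.\<close>

lemma Gamma_nonempty:
  assumes "i \<le> CARD('n)"
  shows "Gamma q i \<noteq> ({} :: ('a ^ 'n) set set)"
  using assms
proof (induction i)
  case 0
  then show ?case
    by (simp add: Gamma_0)
next
  case (Suc i)
  then obtain V :: "('a ^ 'n) set" where "V \<in> Gamma q i"
    by fastforce
  then show ?case
    using Suc.prems by (metis Gamma_extend Suc_le_eq empty_iff)
qed

end

section \<open>Dimensions of intersections with nested subspaces\<close>

text \<open>The sum of \<open>C1 \<inter> V\<close> and \<open>C2 \<inter> W\<close> lies in
  \<open>C1 \<inter> W\<close>, and the two meet in \<open>C2 \<inter> V\<close>; the dimension
  formula for sums does the rest. The additive form avoids truncated subtraction of
  naturals.\<close>

lemma dim_Int_diff_mono:
  fixes C1 C2 V W :: "('a::field ^ 'n) set"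
  assumes "vec.subspace C1" "vec.subspace C2" "C2 \<subseteq> C1"
    and "vec.subspace V" "vec.subspace W" "V \<subseteq> W"
  shows "vec.dim (C1 \<inter> V) + vec.dim (C2 \<inter> W) \<le> vec.dim (C1 \<inter> W) + vec.dim (C2 \<inter> V)"
proof -
  have "vec.dim {x + y |x y. x \<in> C1 \<inter> V \<and> y \<in> C2 \<inter> W} + vec.dim ((C1 \<inter> V) \<inter> (C2 \<inter> W)) =
      vec.dim (C1 \<inter> V) + vec.dim (C2 \<inter> W)"
    using assms by (intro vec.dim_sums_Int vec.subspace_inter)
  moreover have "(C1 \<inter> V) \<inter> (C2 \<inter> W) = C2 \<inter> V"
    using assms by blast
  moreover have "{x + y |x y. x \<in> C1 \<inter> V \<and> y \<in> C2 \<inter> W} \<subseteq> C1 \<inter> W"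
    using assms by (auto intro!: vec.subspace_add)
  then have "vec.dim {x + y |x y. x \<in> C1 \<inter> V \<and> y \<in> C2 \<inter> W} \<le> vec.dim (C1 \<inter> W)"
    by (rule vec.dim_subset)
  ultimately show ?thesis
    by simp
qed

text \<open>This is the preceding inequality for the pair of codes \<open>UNIV\<close> and
  \<open>C\<close>.\<close>

lemma dim_Int_subspace_le:
  fixes C V W :: "('a::field ^ 'n) set"
  assumes "vec.subspace C" "vec.subspace V" "vec.subspace W" "V \<subseteq> W"
  shows "vec.dim (C \<inter> W) + vec.dim V \<le> vec.dim (C \<inter> V) + vec.dim W"
  using dim_Int_diff_mono[of W C V UNIV] dim_Int_diff_mono[of UNIV C V W] assms
  by (simp add: Int_absorb1 Int_absorb2 Int_commute)

section \<open>Cosets, quotient bases and the dimension of a quotient\<close>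

lemma plus_subspace_self:
  assumes "vec.subspace (W :: ('a::field ^ 'n) set)"
  shows "W + W = W"
proof
  show "W + W \<subseteq> W"
    using assms by (auto elim!: set_plus_elim intro: vec.subspace_add)
  show "W \<subseteq> W + W"
    using assms by (intro set_zero_plus2) (rule vec.subspace_0)
qed

lemma elt_set_plus_eq_subspace_iff:
  assumes "vec.subspace (W :: ('a::field ^ 'n) set)"
  shows "x +o W = W \<longleftrightarrow> x \<in> W"
proof
  assume "x +o W = W"
  then show "x \<in> W"
    using vec.subspace_0[OF assms] set_plus_intro2[of 0 W x] by simp
next
  assume x: "x \<in> W"
  show "x +o W = W"
  proof
    show "x +o W \<subseteq> W"
      using x assms by (auto simp: elt_set_plus_def intro: vec.subspace_add)
    show "W \<subseteq> x +o W"
      using x assms by (auto simp flip: set_minus_plus intro: vec.subspace_diff)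
  qed
qed

lemma coset_rep:
  assumes "vec.subspace (W :: ('a::field ^ 'n) set)" and "A \<in> quotient_space V W" and "a \<in> A"
  shows "A = a +o W"
proof -
  obtain v where v: "A = v +o W"
    using assms by (auto simp: quotient_space_def)
  then obtain w where w: "w \<in> W" "a = v + w"
    using assms by (auto simp: elt_set_plus_def)
  then have "a +o W = v +o (w +o W)"
    by (simp add: set_plus_rearrange2)
  then show ?thesis
    using v w elt_set_plus_eq_subspace_iff[OF assms(1), of w] by simp
qed

text \<open>The summand \<open>W\<close> absorbs the multiples \<open>c *s w'\<close>, and for
  \<open>c = 0\<close> it restores the full coset where scaling alone leaves
  \<open>{0}\<close>.\<close>

lemma subspace_plus_scaled_coset:
  assumes W: "vec.subspace (W :: ('a::field ^ 'n) set)"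
  shows "W + (\<lambda>a. c *s a) ` (r +o W) = (c *s r) +o W"
proof
  show "W + (\<lambda>a. c *s a) ` (r +o W) \<subseteq> (c *s r) +o W"
  proof
    fix x assume "x \<in> W + (\<lambda>a. c *s a) ` (r +o W)"
    then obtain w w' where w: "w \<in> W" "w' \<in> W" and x: "x = w + c *s (r + w')"
      by (auto simp: elt_set_plus_def elim!: set_plus_elim)
    have "x - c *s r = w + c *s w'"
      by (simp add: x vec.scale_right_distrib)
    then show "x \<in> (c *s r) +o W"
      using w W by (simp add: vec.subspace_add vec.subspace_scale flip: set_minus_plus)
  qed
  show "(c *s r) +o W \<subseteq> W + (\<lambda>a. c *s a) ` (r +o W)"
  proof
    fix x assume "x \<in> (c *s r) +o W"
    then obtain w where "w \<in> W" "x = w + c *s r"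
      by (auto simp: elt_set_plus_def add.commute)
    moreover have "r \<in> r +o W"
      using set_plus_intro2[OF vec.subspace_0[OF W], of r] by simp
    ultimately show "x \<in> W + (\<lambda>a. c *s a) ` (r +o W)"
      by auto
  qed
qed

text \<open>The single summand \<open>W\<close> is moved along the sum and absorbs one scaled coset
  at a time. Set arithmetic thereby reduces to vector arithmetic on representatives.\<close>

lemma coset_combination_eq:
  assumes W: "vec.subspace (W :: ('a::field ^ 'n) set)" and "finite B"
    and "\<And>A. A \<in> B \<Longrightarrow> A = r A +o W"
  shows "coset_combination W B u = (\<Sum>A\<in>B. u A *s r A) +o W"
  using assms(2,3)
proof (induction B rule: finite_induct)
  case empty
  then show ?case
    by (simp add: coset_combination_def)
next
  case (insert A B)
  have IH: "W + (\<Sum>A\<in>B. (\<lambda>a. u A *s a) ` A) = (\<Sum>A\<in>B. u A *s r A) +o W"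
    using insert by (simp add: coset_combination_def)
  have "coset_combination W (insert A B) u =
      (\<lambda>a. u A *s a) ` A + (W + (\<Sum>A\<in>B. (\<lambda>a. u A *s a) ` A))"
    using insert.hyps by (simp add: coset_combination_def add.left_commute)
  also have "\<dots> = (\<Sum>A\<in>B. u A *s r A) +o (W + (\<lambda>a. u A *s a) ` A)"
    by (simp add: IH set_plus_rearrange4 add.commute)
  also have "W + (\<lambda>a. u A *s a) ` A = (u A *s r A) +o W"
    using insert.prems[of A] subspace_plus_scaled_coset[OF W, of "u A" "r A"] by simp
  finally show ?case
    using insert.hyps by (simp add: set_plus_rearrange2 add.commute)
qed

text \<open>Two cosets agree iff their representatives differ by an element of \<open>W\<close>, so
  a quotient basis amounts to representatives that are independent and spanning modulo
  \<open>W\<close>.\<close>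

lemma quotient_basis_iff:
  assumes W: "vec.subspace (W :: ('a::field ^ 'n) set)" and "finite B" "B \<subseteq> quotient_space V W"
    and r: "\<And>A. A \<in> B \<Longrightarrow> r A \<in> A"
  shows "quotient_basis V W B \<longleftrightarrow>
    (\<forall>u. (\<Sum>A\<in>B. u A *s r A) \<in> W \<longrightarrow> (\<forall>A\<in>B. u A = 0)) \<and>
    (\<forall>v\<in>V. \<exists>u. v - (\<Sum>A\<in>B. u A *s r A) \<in> W)"
proof -
  have *: "coset_combination W B u = (\<Sum>A\<in>B. u A *s r A) +o W" for u
    using assms by (intro coset_combination_eq coset_rep) auto
  have "v +o W = x +o W \<longleftrightarrow> v - x \<in> W" for v x
  proof -
    have "v +o W = x +o ((v - x) +o W)"
      by (simp add: set_plus_rearrange2)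
    then show ?thesis
      using elt_set_plus_eq_subspace_iff[OF W, of "v - x"]
      by (metis W set_minus_plus set_plus_intro2 set_zero_plus vec.subspace_0 add.right_neutral)
  qed
  then show ?thesis
    using assms by (simp add: quotient_basis_def * quotient_space_def elt_set_plus_eq_subspace_iff)
qed

text \<open>Representatives of the basis cosets are independent and span a complement of
  \<open>W\<close> in \<open>V\<close>.\<close>

lemma quotient_basis_card:
  fixes V W :: "('a::field ^ 'n) set"
  assumes V: "vec.subspace V" and W: "vec.subspace W" and "W \<subseteq> V" and B: "quotient_basis V W B"
  shows "card B + vec.dim W = vec.dim V"
proof -
  have fin: "finite B" and B_sub: "B \<subseteq> quotient_space V W"
    using B by (auto simp: quotient_basis_def)
  \<comment> \<open>Representatives are taken inside \<open>V\<close> so that their span stays in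
    \<open>V\<close>.\<close>
  have "\<exists>a. a \<in> A \<and> a \<in> V" if "A \<in> B" for A
    using that B_sub set_plus_intro2[OF vec.subspace_0[OF W]]
    by (fastforce simp: quotient_space_def)
  then obtain r where r: "r A \<in> A" "r A \<in> V" if "A \<in> B" for A
    by metis
  have "(\<forall>u. (\<Sum>A\<in>B. u A *s r A) \<in> W \<longrightarrow> (\<forall>A\<in>B. u A = 0)) \<and>
      (\<forall>v\<in>V. \<exists>u. v - (\<Sum>A\<in>B. u A *s r A) \<in> W)"
    using B by (subst (asm) quotient_basis_iff[OF W fin B_sub r(1)])
  then have indep: "\<And>u. (\<Sum>A\<in>B. u A *s r A) \<in> W \<Longrightarrow> \<forall>A\<in>B. u A = 0"
    and gen: "\<And>v. v \<in> V \<Longrightarrow> \<exists>u. v - (\<Sum>A\<in>B. u A *s r A) \<in> W"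
    by blast+
  \<comment> \<open>A coset is determined by any one of its elements, so distinct cosets have
    distinct representatives.\<close>
  have inj: "inj_on r B"
    using B_sub r(1) coset_rep[OF W] by (intro inj_onI) (metis subsetD)
  define S where "S = r ` B"
  have fin_S: "finite S"
    using fin by (simp add: S_def)
  have sum_S: "(\<Sum>s\<in>S. f s *s s) = (\<Sum>A\<in>B. f (r A) *s r A)" for f
    by (simp add: S_def sum.reindex[OF inj])
  have "vec.independent S"
  proof (rule vec.independent_if_scalars_zero[OF fin_S])
    fix f x assume "(\<Sum>x\<in>S. f x *s x) = 0" "x \<in> S"
    then have "\<forall>A\<in>B. f (r A) = 0"
      using vec.subspace_0[OF W] by (intro indep) (simp add: sum_S)
    then show "f x = 0"
      using \<open>x \<in> S\<close> by (auto simp: S_def)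
  qed
  then have "vec.dim (vec.span S) = card B"
    by (simp add: vec.dim_eq_card_independent S_def card_image[OF inj])
  moreover have "vec.span S \<inter> W \<subseteq> {0}"
    using indep by (fastforce simp: vec.span_finite[OF fin_S] sum_S)
  then have "vec.dim (vec.span S \<inter> W) = 0"
    by (rule vec.dim_eq_0[THEN iffD2])
  moreover have "{x + y |x y. x \<in> vec.span S \<and> y \<in> W} = V"
  proof
    have "vec.span S \<subseteq> V"
      using V r by (intro vec.span_minimal) (auto simp: S_def)
    then show "{x + y |x y. x \<in> vec.span S \<and> y \<in> W} \<subseteq> V"
      using \<open>W \<subseteq> V\<close> V by (auto intro: vec.subspace_add)
    show "V \<subseteq> {x + y |x y. x \<in> vec.span S \<and> y \<in> W}"
    proof
      fix v assume "v \<in> V"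
      then obtain u where "v - (\<Sum>A\<in>B. u A *s r A) \<in> W"
        using gen by blast
      moreover have "(\<Sum>A\<in>B. u A *s r A) \<in> vec.span S"
        by (intro vec.span_sum vec.span_scale vec.span_base) (simp add: S_def)
      moreover have "v = (\<Sum>A\<in>B. u A *s r A) + (v - (\<Sum>A\<in>B. u A *s r A))"
        by simp
      ultimately show "v \<in> {x + y |x y. x \<in> vec.span S \<and> y \<in> W}"
        by blast
    qed
  qed
  ultimately show ?thesis
    using vec.dim_sums_Int[OF vec.subspace_span W, of S] by (simp del: vec.dim_eq_0)
qed

text \<open>A basis \<open>D\<close> of \<open>W\<close> is extended to a basis \<open>E\<close> of
  \<open>V\<close>; the cosets of the added vectors \<open>E - D\<close> form a quotient
  basis.\<close>

lemma quotient_basis_exists: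
  fixes V W :: "('a::field ^ 'n) set"
  assumes V: "vec.subspace V" and W: "vec.subspace W" and "W \<subseteq> V"
  shows "\<exists>B. quotient_basis V W B"
proof -
  obtain D where D: "D \<subseteq> W" "vec.independent D" "W \<subseteq> vec.span D"
    using vec.basis_exists by metis
  then obtain E where E: "D \<subseteq> E" "E \<subseteq> V" "vec.independent E" "V \<subseteq> vec.span E"
    using \<open>W \<subseteq> V\<close> by (meson order_trans vec.maximal_independent_subset_extend)
  have span_D: "vec.span D = W"
    using D W by (meson order_antisym vec.span_minimal)
  have fin: "finite E"
    using E(3) by (rule vec.finiteI_independent)
  define S where "S = E - D"
  have fin_S: "finite S" and fin_D: "finite D"
    using fin E(1) finite_subset by (auto simp: S_def)
  have indep: "\<forall>s\<in>S. f s = 0" if "(\<Sum>s\<in>S. f s *s s) \<in> W" for f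
  proof -
    have "(\<Sum>s\<in>S. f s *s s) \<in> range (\<lambda>g. \<Sum>d\<in>D. g d *s d)"
      using that vec.span_finite[OF fin_D] span_D by simp
    then obtain g where g: "(\<Sum>s\<in>S. f s *s s) = (\<Sum>d\<in>D. g d *s d)"
      by (rule rangeE)
    \<comment> \<open>Moving the \<open>D\<close>-part to the other side gives a vanishing
      combination over all of \<open>E\<close>, whose coefficients are \<open>h\<close>.\<close>
    define h where "h x = (if x \<in> D then - g x else f x)" for x
    have "(\<Sum>x\<in>E. h x *s x) = (\<Sum>x\<in>S. h x *s x) + (\<Sum>x\<in>D. h x *s x)"
      unfolding S_def using E(1) fin by (rule sum.subset_diff)
    also have "(\<Sum>x\<in>S. h x *s x) = (\<Sum>s\<in>S. f s *s s)"
      by (rule sum.cong) (auto simp: h_def S_def)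
    also have "(\<Sum>x\<in>D. h x *s x) = - (\<Sum>d\<in>D. g d *s d)"
      by (simp add: h_def sum_negf)
    finally have "(\<Sum>x\<in>E. h x *s x) = 0"
      using g by simp
    then have "h x = 0" if "x \<in> E" for x
      using vec.independentD[OF E(3) fin order_refl] that by blast
    then have "h s = 0" if "s \<in> S" for s
      using that by (simp add: S_def)
    then show ?thesis
      by (auto simp: h_def S_def)
  qed
  define B where "B = (\<lambda>s. s +o W) ` S"
  have inj: "inj_on (\<lambda>s. s +o W) S"
  proof (rule inj_onI, rule ccontr)
    fix s t assume st: "s \<in> S" "t \<in> S" "s +o W = t +o W" "s \<noteq> t"
    \<comment> \<open>If two added vectors had the same coset, \<open>s - t\<close> in
      \<open>W\<close> would be a relation modulo \<open>W\<close> with coefficients 1 and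
      -1.\<close>
    let ?f = "\<lambda>x. if x = s then 1 else if x = t then - 1 else 0 :: 'a"
    have "s - t \<in> W"
      using st set_plus_intro2[OF vec.subspace_0[OF W], of s] by (simp add: set_minus_plus)
    moreover have "(\<Sum>x\<in>S. ?f x *s x) = (\<Sum>x\<in>{s, t}. ?f x *s x)"
      using st fin_S by (intro sum.mono_neutral_right) auto
    ultimately have "\<forall>x\<in>S. ?f x = 0"
      using st by (intro indep) simp
    then show False
      using st by auto
  qed
  define r where "r = the_inv_into S (\<lambda>s. s +o W)"
  have r: "r (s +o W) = s" if "s \<in> S" for s
    unfolding r_def using inj that by (rule the_inv_into_f_f)
  have sum_B: "(\<Sum>A\<in>B. u A *s r A) = (\<Sum>s\<in>S. u (s +o W) *s s)" for u
    by (simp add: B_def sum.reindex[OF inj] r)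
  have "quotient_basis V W B"
  proof (subst quotient_basis_iff[OF W, where r = r], goal_cases)
    case 1
    show ?case using fin_S by (simp add: B_def)
  next
    case 2
    show ?case using E(2) by (auto simp: B_def S_def quotient_space_def)
  next
    case (3 A)
    then show ?case
      using set_plus_intro2[OF vec.subspace_0[OF W]] by (fastforce simp: B_def r)
  next
    case 4
    have "\<exists>u. v - (\<Sum>A\<in>B. u A *s r A) \<in> W" if "v \<in> V" for v
    proof -
      obtain f where f: "v = (\<Sum>x\<in>E. f x *s x)"
        using \<open>v \<in> V\<close> E(4) by (auto simp: vec.span_finite[OF fin])
      \<comment> \<open>Only the coefficients on \<open>S\<close> matter modulo \<open>W\<close>,
        because the \<open>D\<close>-part of \<open>v\<close> lies in \<open>W\<close>.\<close>
      have "v = (\<Sum>x\<in>S. f x *s x) + (\<Sum>x\<in>D. f x *s x)"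
        unfolding f S_def using E(1) fin by (rule sum.subset_diff)
      then have "v - (\<Sum>A\<in>B. f (r A) *s r A) = (\<Sum>x\<in>D. f x *s x)"
        by (simp add: sum_B r)
      also have "\<dots> \<in> W"
        using D(1) W by (auto intro!: vec.subspace_sum vec.subspace_scale)
      finally show ?thesis
        by (rule exI[of _ "\<lambda>A. f (r A)"])
    qed
    moreover have "\<forall>A\<in>B. u A = 0" if "(\<Sum>A\<in>B. u A *s r A) \<in> W" for u
    proof -
      have "\<forall>s\<in>S. u (s +o W) = 0"
        using that unfolding sum_B by (rule indep)
      then show ?thesis
        by (simp add: B_def)
    qed
    ultimately show ?case
      by blast
  qed
  then show ?thesis ..
qed

text \<open>All quotient bases have the cardinality given by \<open>quotient_basis_card\<close>, and
  one exists, so the definite description denotes that number.\<close>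

lemma quotient_dim_eq:
  fixes V W :: "('a::field ^ 'n) set"
  assumes "vec.subspace V" "vec.subspace W" "W \<subseteq> V"
  shows "int (quotient_dim V W) = int (vec.dim V) - int (vec.dim W)"
proof -
  obtain B where B: "quotient_basis V W B"
    using quotient_basis_exists[OF assms] by blast
  have "quotient_dim V W = card B"
    unfolding quotient_dim_def
  proof (rule the_equality)
    show "\<exists>B'. quotient_basis V W B' \<and> card B' = card B"
      using B by blast
  next
    fix d assume "\<exists>B'. quotient_basis V W B' \<and> card B' = d"
    then show "d = card B"
      using quotient_basis_card[OF assms] B by (metis add_right_cancel)
  qed
  then show ?thesis
    using quotient_basis_card[OF assms B] by simp
qed

section \<open>Steps and end values of the relative profile\<close>

theorem theorem8:
  fixes C1 C2 :: "('a::{field,finite} ^ 'n) set" and q m :: nat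
  assumes "primepow q" and "m \<ge> 1" and "CARD('a) = q ^ m"
    and "vec.subspace C1" and "vec.subspace C2" and "C2 \<subset> C1"
  shows "mono_on {0..CARD('n)} (\<lambda>i. relative_profile q i C1 C2) \<and>
         relative_profile q 0 C1 C2 = 0 \<and>
         relative_profile q CARD('n) C1 C2 = int (quotient_dim C1 C2) \<and>
         (\<forall>i < CARD('n).
            0 \<le> relative_profile q (i + 1) C1 C2 - relative_profile q i C1 C2 \<and>
            relative_profile q (i + 1) C1 C2 - relative_profile q i C1 C2 \<le> 1)"
proof -
  note field = assms(1,3)
  have C: "vec.subspace C1" "vec.subspace C2" "C2 \<subseteq> C1"
    using assms(4-6) by auto
  define f where "f V = int (vec.dim (C1 \<inter> V)) - int (vec.dim (C2 \<inter> V))" for V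
  have K: "relative_profile q i C1 C2 = Max (f ` Gamma q i)" for i
    by (simp add: relative_profile_def f_def[abs_def])
  have le_K: "f V \<le> relative_profile q i C1 C2" if "V \<in> Gamma q i" for V i
    using that by (simp add: K)
  have attained: "\<exists>V \<in> Gamma q i. relative_profile q i C1 C2 = f V" if "i \<le> CARD('n)" for i
  proof -
    have "Max (f ` Gamma q i) \<in> f ` Gamma q i"
      using Gamma_nonempty[OF field that] by (intro Max_in) auto
    then show ?thesis
      by (auto simp: K)
  qed
  have step_ge: "relative_profile q i C1 C2 \<le> relative_profile q (Suc i) C1 C2"
    if i: "i < CARD('n)" for i
  proof -
    obtain V where V: "V \<in> Gamma q i" "relative_profile q i C1 C2 = f V"
      using attained i less_imp_le by blast
    obtain W where W: "W \<in> Gamma q (Suc i)" "V \<subseteq> W"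
      using Gamma_extend[OF field V(1) i] .
    \<comment> \<open>Enlarging a maximizer \<open>V\<close> for \<open>i\<close> cannot lower the
      difference, and \<open>W\<close> competes in the maximum for \<open>Suc i\<close>.\<close>
    have "f V \<le> f W"
      using dim_Int_diff_mono[OF C, of V W] V W by (simp add: f_def Gamma_def)
    then show ?thesis
      using V(2) le_K[OF W(1)] by simp
  qed
  have step_le: "relative_profile q (Suc i) C1 C2 \<le> relative_profile q i C1 C2 + 1"
    if i: "i < CARD('n)" for i
  proof -
    obtain W where W: "W \<in> Gamma q (Suc i)" "relative_profile q (Suc i) C1 C2 = f W"
      using attained i Suc_leI by blast
    obtain V where V: "V \<in> Gamma q i" "V \<subseteq> W"
      using Gamma_cut[OF field W(1)] .
    \<comment> \<open>Cutting a maximizer \<open>W\<close> for \<open>Suc i\<close> costs at most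
      one dimension in \<open>C1\<close>, while the subtracted dimension for \<open>C2\<close>
      cannot grow.\<close>
    have "vec.dim (C1 \<inter> W) \<le> vec.dim (C1 \<inter> V) + 1"
      using dim_Int_subspace_le[OF C(1), of V W] V W by (simp add: Gamma_def)
    moreover have "vec.dim (C2 \<inter> V) \<le> vec.dim (C2 \<inter> W)"
      using V by (intro vec.dim_subset) blast
    ultimately have "f W \<le> f V + 1"
      by (simp add: f_def)
    then show ?thesis
      using W(2) le_K[OF V(1)] by simp
  qed
  have "relative_profile q i C1 C2 \<le> relative_profile q j C1 C2" if "i \<le> j" "j \<le> CARD('n)" for i j
    using that
  proof (induction j rule: dec_induct)
    case (step j)
    then show ?case
      using step_ge[of j] by simp
  qed simp
  then have "mono_on {0..CARD('n)} (\<lambda>i. relative_profile q i C1 C2)"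
    by (auto intro: mono_onI)
  moreover have "relative_profile q 0 C1 C2 = 0"
  proof -
    have "C1 \<inter> {0} = {0}" "C2 \<inter> {0} = {0}"
      using C vec.subspace_0 by auto
    then show ?thesis
      by (simp add: K Gamma_0[OF field] f_def)
  qed
  moreover have "relative_profile q CARD('n) C1 C2 = int (quotient_dim C1 C2)"
    by (simp add: K Gamma_CARD[OF field] f_def quotient_dim_eq[OF C])
  ultimately show ?thesis
    using step_ge step_le by (force simp: algebra_simps)
qed

end
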